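(* For every $d\ge3$ there exists a copula $C\in\mathcal{C}^d_{\rm c}$ with $d_\infty(C,\psi(C))\ge\frac18$; in particular $\sup_{C\in\mathcal{C}^d_{\rm c}}d_\infty(C,\psi(C))\ge\frac18$.
   Context: $\mathbb{I}=[0,1]$, $\lambda$ Lebesgue measure, $d_\infty$ the uniform distance between $d$-dimensional copulas. For a $d$-dimensional copula $C$ and $J\subseteq\{1,\dots,d\}$, $C_J$ is the marginal copula of the coordinates in $J$ and $\mu_{C_J}$ its measure. For $J$ with $|J|\ge2$ and $\emptyset\ne L\subseteq J$ with $|L|\le|J|-2$, $F_{j|L}(\cdot|\mathbf{t})$ ($j\in J\setminus L$) denote the univariate conditional distribution functions of coordinate $j$ given the coordinates in $L$ equal $\mathbf{t}$ (derived from a regular conditional distribution under $C_J$), and $C^{\mathbf{t}}_{J\setminus L;L}$ the corresponding conditional copula of the coordinates $J\setminus L$ given $\mathbf{t}$ (copula of that conditional distribution). $\mathcal{C}^d_{\rm c}$ is the family of $d$-dimensional copulas for which all these conditional univariate distribution functions are continuous for $\mu_{C_L}$-a.e. $\mathbf{t}$ (so the conditional copulas are a.e. unique). Partial vine copula of D-vine structure: for $C\in\mathcal{C}^d_{\rm c}$ define $C^{\rm PVC}$ recursively. Set $(C^{\rm PVC})_{i,i+1}:=C_{i,i+1}$, $i=1,\dots,d-1$. For $k=2,\dots,d-1$ and $i=1,\dots,d-k$, with $M=\{i+1,\dots,i+k-1\}$: the partial copula $(C_p)_{i,i+k}(a,b):=\int_{\mathbb{I}^{k-1}}C^{\mathbf{w}}_{\{i,i+k\};M}(a,b)\,d\mu_{(C^{\rm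 PVC})_M}(\mathbf{w})$ (for $k=2$, $\mu_{(C^{\rm PVC})_M}=\lambda$), and $(C^{\rm PVC})_{i,\dots,i+k}(u_i,\dots,u_{i+k}):=\int_{\times_{m\in M}[0,u_m]}(C_p)_{i,i+k}\big(F^{\rm PVC}_{i|M}(u_i|\mathbf{t}),F^{\rm PVC}_{i+k|M}(u_{i+k}|\mathbf{t})\big)\,d\mu_{(C^{\rm PVC})_M}(\mathbf{t})$, where $F^{\rm PVC}_{i|M}$ and $F^{\rm PVC}_{i+k|M}$ are the conditional univariate distribution functions of coordinate $i$ resp. $i+k$ given the coordinates in $M$, computed from the previously constructed copulas $(C^{\rm PVC})_{i,\dots,i+k-1}$ resp. $(C^{\rm PVC})_{i+1,\dots,i+k}$. Finally $\psi(C):=C^{\rm PVC}=(C^{\rm PVC})_{1,\dots,d}$, defining $\psi:\mathcal{C}^d_{\rm c}\to\mathcal{C}^d_{\rm c}$. *)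

theory Defs
  imports "HOL-Probability.Probability"
begin

text \<open>Points of [0,1]^J are functions nat => real; coordinates outside J are irrelevant.\<close>

definition PM :: "nat set \<Rightarrow> (nat \<Rightarrow> real) measure" where
  "PM J = PiM J (\<lambda>_. (borel :: real measure))"

definition marg :: "nat set \<Rightarrow> (nat \<Rightarrow> real) measure \<Rightarrow> (nat \<Rightarrow> real) measure" where
  "marg L \<mu> = distr \<mu> (PM L) (\<lambda>x. restrict x L)"

definition cdf_on :: "nat set \<Rightarrow> (nat \<Rightarrow> real) measure \<Rightarrow> (nat \<Rightarrow> real) \<Rightarrow> real" where
  "cdf_on J \<mu> u = measure \<mu> {x \<in> space (PM J). \<forall>j\<in>J. x j \<le> u j}"

definition unit_cube :: "nat set \<Rightarrow> (nat \<Rightarrow> real) set" where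
  "unit_cube J = {u. \<forall>j\<in>J. 0 \<le> u j \<and> u j \<le> 1}"

text \<open>(The measure of) a copula on the coordinates J: a probability measure on R^J
  all of whose univariate marginals are uniform on [0,1].  The copula itself is cdf_on J.\<close>
definition is_copula :: "nat set \<Rightarrow> (nat \<Rightarrow> real) measure \<Rightarrow> bool" where
  "is_copula J \<mu> \<longleftrightarrow> sets \<mu> = sets (PM J) \<and> prob_space \<mu> \<and>
     (\<forall>j\<in>J. distr \<mu> borel (\<lambda>x. x j) = uniform_measure lborel {0..1})"

definition d_inf :: "nat set \<Rightarrow> (nat \<Rightarrow> real) measure \<Rightarrow> (nat \<Rightarrow> real) measure \<Rightarrow> real" where
  "d_inf J \<mu> \<nu> = (SUP u \<in> unit_cube J. \<bar>cdf_on J \<mu> u - cdf_on J \<nu> u\<bar>)"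

definition is_rcd :: "(nat \<Rightarrow> real) measure \<Rightarrow> nat set \<Rightarrow> nat set
    \<Rightarrow> ((nat \<Rightarrow> real) \<Rightarrow> (nat \<Rightarrow> real) measure) \<Rightarrow> bool" where
  "is_rcd \<mu> L R K \<longleftrightarrow>
     K \<in> measurable (PM L) (prob_algebra (PM R)) \<and>
     (\<forall>A\<in>sets (PM L). \<forall>B\<in>sets (PM R).
        emeasure \<mu> {x \<in> space \<mu>. restrict x L \<in> A \<and> restrict x R \<in> B} =
        (\<integral>\<^sup>+ t. indicator A t * emeasure (K t) B \<partial>marg L \<mu>))"

definition cond_df :: "((nat \<Rightarrow> real) \<Rightarrow> (nat \<Rightarrow> real) measure) \<Rightarrow> nat
    \<Rightarrow> real \<Rightarrow> (nat \<Rightarrow> real) \<Rightarrow> real" where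
  "cond_df K j u t = measure (K t) {y \<in> space (K t). y j \<le> u}"

text \<open>Conditional copula (measure) of the coordinates R given t: the copula of the
  conditional distribution K t, obtained by the probability integral transform
  (unique when the conditional marginals are continuous).\<close>
definition cond_copula :: "nat set \<Rightarrow> ((nat \<Rightarrow> real) \<Rightarrow> (nat \<Rightarrow> real) measure)
    \<Rightarrow> (nat \<Rightarrow> real) \<Rightarrow> (nat \<Rightarrow> real) measure" where
  "cond_copula R K t = distr (K t) (PM R) (\<lambda>y. restrict (\<lambda>j. cond_df K j (y j) t) R)"

definition Cc :: "nat \<Rightarrow> (nat \<Rightarrow> real) measure \<Rightarrow> bool" where
  "Cc d \<mu> \<longleftrightarrow> is_copula {1..d} \<mu> \<and>
     (\<forall>J L j K. J \<subseteq> {1..d} \<and> 2 \<le> card J \<and> L \<noteq> {} \<and> L \<subseteq> J \<and> card L + 2 \<le> card J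
        \<and> j \<in> J - L \<and> is_rcd (marg J \<mu>) L {j} K
        \<longrightarrow> (AE t in marg L \<mu>. \<forall>u. isCont (\<lambda>v. cond_df K j v t) u))"

definition copula_of_cdf :: "nat set \<Rightarrow> ((nat \<Rightarrow> real) \<Rightarrow> real) \<Rightarrow> (nat \<Rightarrow> real) measure" where
  "copula_of_cdf J F = (SOME \<nu>. is_copula J \<nu> \<and> (\<forall>u\<in>unit_cube J. cdf_on J \<nu> u = F u))"

text \<open>D-vine partial vine copula: pvc \<mu> i k is (the measure of) (C^PVC)_{i,...,i+k}.\<close>
fun pvc :: "(nat \<Rightarrow> real) measure \<Rightarrow> nat \<Rightarrow> nat \<Rightarrow> (nat \<Rightarrow> real) measure" where
  "pvc \<mu> i 0 = marg {i} \<mu>"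
| "pvc \<mu> i (Suc 0) = marg {i, i+1} \<mu>"
| "pvc \<mu> i (Suc (Suc k)) =
    (let M = {i+1..i+k+1};
         e = i + k + 2;
         \<nu>M = pvc \<mu> (i+1) k;
         left = pvc \<mu> i (Suc k);
         right = pvc \<mu> (i+1) (Suc k);
         KL = (SOME K. is_rcd left M {i} K);
         KR = (SOME K. is_rcd right M {e} K);
         KC = (SOME K. is_rcd (marg {i..e} \<mu>) M {i, e} K);
         Cp = (\<lambda>a b. \<integral> w. cdf_on {i, e} (cond_copula {i, e} KC w)
                               (\<lambda>j. if j = i then a else b) \<partial>\<nu>M);
         F = (\<lambda>u. \<integral> t. indicator {t. \<forall>m\<in>M. 0 \<le> t m \<and> t m \<le> u m} t *
                         Cp (cond_df KL i (u i) t) (cond_df KR e (u e) t) \<partial>\<nu>M)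
     in copula_of_cdf {i..e} F)"

definition psi :: "nat \<Rightarrow> (nat \<Rightarrow> real) measure \<Rightarrow> (nat \<Rightarrow> real) measure" where
  "psi d \<mu> = pvc \<mu> 1 (d - 1)"

end

theory Submission
  imports Defs
begin

text \<open>
  Let \<open>s\<close> be \<open>1\<close> on \<open>[0,1/2]\<close> and \<open>-1\<close> on \<open>(1/2,1]\<close>.  The witness is the copula on \<open>[0,1]\<^sup>d\<close> with density
  \<open>1 + s(x\<^sub>1) s(x\<^sub>2) s(x\<^sub>d)\<close>.  Since \<open>s\<close> integrates to zero, every margin missing one of the coordinates
  \<open>1, 2, d\<close> is the independence copula, so all edges of the D-vine below the last one carry independence.
  On the last edge the conditional copula of coordinates \<open>1, d\<close> has density \<open>1 + s(w\<^sub>2) s(x\<^sub>1) s(x\<^sub>d)\<close>,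
  which averages over \<open>w\<close> to independence.  Hence the partial vine copula is the independence copula, and
  at \<open>u\<^sub>1 = u\<^sub>2 = u\<^sub>d = 1/2\<close> (all other entries \<open>1\<close>) the two copulas take the values \<open>1/4\<close> and \<open>1/8\<close>.
\<close>

section \<open>The uniform law and the parity density\<close>

definition unif :: "real measure" where
  "unif = uniform_measure lborel {0..1}"

lemma sets_unif [simp, measurable_cong]: "sets unif = sets borel"
  by (simp add: unif_def)

lemma space_unif [simp]: "space unif = UNIV"
  by (simp add: unif_def)

interpretation unif: prob_space unif
  unfolding unif_def by (rule prob_space_uniform_measure) auto

interpretation unifs: product_sigma_finite "\<lambda>_::nat. unif"
  by unfold_locales

lemma measure_unif_atMost: "measure unif {..a} = max 0 (min 1 a)"
proof -
  have "{0..1} \<inter> {..a} = {0..min 1 a}" by auto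
  moreover have "emeasure unif {..a} = emeasure lborel ({0..1} \<inter> {..a})"
    by (simp add: unif_def divide_ennreal_def)
  ultimately show ?thesis
    by (auto simp: measure_def max_def min_def)
qed

lemma emeasure_unif_singleton: "emeasure unif {a} = 0"
  unfolding unif_def by (cases "a \<in> {0..1}") auto

lemma AE_unif: "AE x in unif. 0 \<le> x \<and> x \<le> 1"
  unfolding unif_def by (auto intro!: AE_uniform_measureI)

definition half_sign :: "real \<Rightarrow> real" where
  "half_sign x = (if x \<le> 1/2 then 1 else -1)"

lemma half_sign_measurable [measurable]: "half_sign \<in> borel_measurable borel"
  unfolding half_sign_def by measurable

lemma integrable_half_sign [simp]:
  "integrable unif half_sign" "A \<in> sets borel \<Longrightarrow> integrable unif (\<lambda>x. half_sign x * indicator A x)"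
  by (auto intro!: unif.integrable_const_bound[where B=1] simp: half_sign_def split: split_indicator)

lemma integral_half_sign_half: "(\<integral>x. half_sign x * indicator {..1/2} x \<partial>unif) = 1/2"
proof -
  have "(\<integral>x. half_sign x * indicator {..1/2} x \<partial>unif) = (\<integral>x. indicator {..1/2} x \<partial>unif)"
    by (intro Bochner_Integration.integral_cong) (auto simp: half_sign_def split: split_indicator)
  then show ?thesis by (simp add: measure_unif_atMost)
qed

lemma integral_half_sign: "(\<integral>x. half_sign x \<partial>unif) = 0"
proof -
  have "(\<integral>x. half_sign x \<partial>unif) = (\<integral>x. 2 * indicator {..1/2} x - 1 \<partial>unif)"
    by (intro Bochner_Integration.integral_cong) (auto simp: half_sign_def split: split_indicator)
  also have "\<dots> = 2 * measure unif {..1/2} - 1"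
    by (subst Bochner_Integration.integral_diff)
       (auto simp: unif.prob_space[simplified] intro!: unif.integrable_const_bound[where B=1])
  finally show ?thesis by (simp add: measure_unif_atMost)
qed

text \<open>A Walsh function. For \<open>T = {}\<close> it is the constant 1, the degenerate case
  that arises when all of \<open>T\<close> has been conditioned on.\<close>

definition parity :: "nat set \<Rightarrow> (nat \<Rightarrow> real) \<Rightarrow> real" where
  "parity T x = (\<Prod>i\<in>T. half_sign (x i))"

lemma parity_cases: "parity T x = 1 \<or> parity T x = -1"
  unfolding parity_def by (induction T rule: infinite_finite_induct) (auto simp: half_sign_def)

lemma abs_parity [simp]: "\<bar>parity T x\<bar> = 1"
  using parity_cases[of T x] by auto

lemma parity_measurable [measurable]:
  "T \<subseteq> J \<Longrightarrow> parity T \<in> borel_measurable (PM J)"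
  unfolding parity_def PM_def by (intro borel_measurable_prod) (auto intro!: measurable_compose[OF measurable_component_singleton])

lemma sum_parity_nonneg: "\<bar>c\<bar> \<le> 1 \<Longrightarrow> 0 \<le> 1 + c * parity T x"
  using parity_cases[of T x] by auto

definition indep_copula :: "nat set \<Rightarrow> (nat \<Rightarrow> real) measure" where
  "indep_copula J = PiM J (\<lambda>_. unif)"

lemma sets_indep_copula [simp, measurable_cong]: "sets (indep_copula J) = sets (PM J)"
  unfolding indep_copula_def PM_def by (intro sets_PiM_cong) auto

lemma space_PM: "space (PM J) = extensional J"
  by (simp add: PM_def space_PiM PiE_UNIV_domain PiE_def)

lemma space_indep_copula [simp]: "space (indep_copula J) = space (PM J)"
  by (rule sets_eq_imp_space_eq) simp

lemma prob_space_indep_copula: "prob_space (indep_copula J)"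
  unfolding indep_copula_def by (rule prob_space_PiM) (rule unif.prob_space_axioms)

text \<open>The coefficient is a parameter because conditioning on part of \<open>T\<close>
  multiplies it by a sign; \<open>c = 0\<close> puts independence into the same family. For
  \<open>\<bar>c\<bar> \<le> 1\<close> the density is nonnegative, so \<open>ennreal\<close>
  truncates nothing.\<close>

definition parity_copula :: "real \<Rightarrow> nat set \<Rightarrow> nat set \<Rightarrow> (nat \<Rightarrow> real) measure" where
  "parity_copula c T J = density (indep_copula J) (\<lambda>x. ennreal (1 + c * parity T x))"

lemma sets_parity_copula [simp, measurable_cong]: "sets (parity_copula c T J) = sets (PM J)"
  by (simp add: parity_copula_def)

lemma space_parity_copula [simp]: "space (parity_copula c T J) = space (PM J)"
  by (simp add: parity_copula_def)

lemma parity_copula_0 [simp]: "parity_copula 0 T J = indep_copula J"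
  by (simp add: parity_copula_def density_1)

text \<open>Both summands of the density, multiplied by the box indicator, are products of functions
  of one coordinate, so each integral factors.\<close>

lemma measure_parity_copula_box:
  assumes J: "finite J" and T: "T \<subseteq> J" and c: "\<bar>c\<bar> \<le> 1" and E: "\<And>j. j \<in> J \<Longrightarrow> E j \<in> sets borel"
  shows "measure (parity_copula c T J) (PiE J E) = (\<Prod>j\<in>J. measure unif (E j)) +
     c * (\<Prod>j\<in>J. if j \<in> T then (\<integral>x. half_sign x * indicator (E j) x \<partial>unif) else measure unif (E j))"
proof -
  interpret P: prob_space "indep_copula J" by (rule prob_space_indep_copula)
  note [measurable] = parity_measurable[OF T]
  have meas: "PiE J E \<in> sets (PM J)"
    unfolding PM_def using J E by (intro sets_PiM_I_finite) auto
  let ?f = "\<lambda>j x. indicator (E j) x :: real"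
  let ?g = "\<lambda>j x. (if j \<in> T then half_sign x else 1) * indicator (E j) x :: real"
  have ind: "indicator (PiE J E) x = (\<Prod>j\<in>J. ?f j (x j))" if "x \<in> space (indep_copula J)" for x
    using that J by (auto simp: space_PM indicator_def PiE_def Pi_def)
  \<comment> \<open>\<open>T \<subseteq> J\<close> lets the product over \<open>T\<close> be read as
    a product over \<open>J\<close> with factor 1 outside \<open>T\<close>.\<close>
  have par: "parity T x * indicator (PiE J E) x = (\<Prod>j\<in>J. ?g j (x j))"
    if "x \<in> space (indep_copula J)" for x
    unfolding ind[OF that] prod.distrib parity_def using J T
    by (simp add: prod.If_cases Int_absorb1)
  have intf: "integrable (indep_copula J) (\<lambda>x. \<Prod>j\<in>J. ?f j (x j))"
    unfolding indep_copula_def using J E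
    by (intro unifs.product_integrable_prod) (auto simp: unif.emeasure_eq_measure)
  have integrable_g: "integrable unif (?g j)" if "j \<in> J" for j
    using E[OF that] by (cases "j \<in> T") (auto simp: unif.emeasure_eq_measure)
  have intg: "integrable (indep_copula J) (\<lambda>x. \<Prod>j\<in>J. ?g j (x j))"
    unfolding indep_copula_def using J E
    by (intro unifs.product_integrable_prod integrable_g) auto
  have "measure (parity_copula c T J) (PiE J E) = (\<integral>x. indicator (PiE J E) x \<partial>parity_copula c T J)"
    using meas by (simp add: sets.sets_into_space Int_absorb2)
  also have "\<dots> = (\<integral>x. (1 + c * parity T x) * indicator (PiE J E) x \<partial>indep_copula J)"
    unfolding parity_copula_def using meas c
    by (subst integral_density) (auto simp: sum_parity_nonneg)
  also have "\<dots> = (\<integral>x. (\<Prod>j\<in>J. ?f j (x j)) + c * (\<Prod>j\<in>J. ?g j (x j)) \<partial>indep_copula J)"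
    by (intro Bochner_Integration.integral_cong refl)
       (simp only: par[symmetric] ind[symmetric] distrib_right mult_1_left mult.assoc)
  also have "\<dots> = (\<integral>x. (\<Prod>j\<in>J. ?f j (x j)) \<partial>indep_copula J) + c * (\<integral>x. (\<Prod>j\<in>J. ?g j (x j)) \<partial>indep_copula J)"
    using intf intg by simp
  also have "(\<integral>x. (\<Prod>j\<in>J. ?f j (x j)) \<partial>indep_copula J) = (\<Prod>j\<in>J. measure unif (E j))"
    unfolding indep_copula_def using J E
    by (subst unifs.product_integral_prod) (auto simp: unif.emeasure_eq_measure)
  also have "(\<integral>x. (\<Prod>j\<in>J. ?g j (x j)) \<partial>indep_copula J) =
     (\<Prod>j\<in>J. if j \<in> T then (\<integral>x. half_sign x * indicator (E j) x \<partial>unif) else measure unif (E j))"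
    unfolding indep_copula_def using J E
    by (subst unifs.product_integral_prod)
       (auto intro!: integrable_g prod.cong)
  finally show ?thesis .
qed

text \<open>On the full space every coordinate in \<open>T\<close> contributes the mean of
  \<open>half_sign\<close>, which is zero; so the perturbation has no mass once \<open>T\<close> is
  nonempty.\<close>

lemma prob_space_parity_copula:
  assumes J: "finite J" and T: "T \<subseteq> J" "T \<noteq> {}" and c: "\<bar>c\<bar> \<le> 1"
  shows "prob_space (parity_copula c T J)"
proof -
  have 1: "measure (parity_copula c T J) (PiE J (\<lambda>_. UNIV)) = 1"
    using J T by (subst measure_parity_copula_box[OF J T(1) c])
      (auto simp: integral_half_sign unif.prob_space[simplified])
  have "PiE J (\<lambda>_. UNIV) = space (parity_copula c T J)"
    by (simp add: space_PM PiE_UNIV_domain PiE_def)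
  \<comment> \<open>The value 1 of \<open>measure\<close> also excludes infinite mass, for which
    \<open>measure\<close> would return 0.\<close>
  with 1 show ?thesis
    by (intro prob_spaceI) (metis emeasure_eq_ennreal_measure ennreal_1 measure_zero_top zero_neq_one)
qed

section \<open>Margins and conditional distributions of parity copulas\<close>

lemma measurable_restrict_PM [measurable]:
  "L \<subseteq> J \<Longrightarrow> (\<lambda>x. restrict x L) \<in> measurable (PM J) (PM L)"
  unfolding PM_def by (rule measurable_restrict_subset)

lemma measurable_component_PM [measurable]:
  "j \<in> J \<Longrightarrow> (\<lambda>x. x j) \<in> borel_measurable (PM J)"
  unfolding PM_def by (rule measurable_component_singleton)

lemma parity_merge:
  assumes "finite L" "finite R" "L \<inter> R = {}" "T \<subseteq> L \<union> R"
  shows "parity T (merge L R (x, y)) = parity (T \<inter> L) x * parity (T \<inter> R) y"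
proof -
  have "parity T (merge L R (x, y)) = parity ((T \<inter> L) \<union> (T \<inter> R)) (merge L R (x, y))"
    using assms by (intro arg_cong[where f="\<lambda>T. parity T _"]) auto
  also have "\<dots> = (\<Prod>i\<in>T \<inter> L. half_sign (merge L R (x, y) i)) * (\<Prod>i\<in>T \<inter> R. half_sign (merge L R (x, y) i))"
    unfolding parity_def using assms by (intro prod.union_disjoint) auto
  also have "\<dots> = parity (T \<inter> L) x * parity (T \<inter> R) y"
    unfolding parity_def using assms by (intro arg_cong2[where f="(*)"] prod.cong) auto
  finally show ?thesis .
qed

text \<open>Fubini for \<open>merge\<close>: freezing \<open>x\<close> turns the density into a
  parity density in \<open>y\<close> with coefficient \<open>c * parity (T \<inter> L) x\<close>.
  Margins and conditional distributions are both read off from this identity.\<close>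

lemma emeasure_parity_copula_split:
  assumes LR: "finite L" "finite R" "L \<inter> R = {}" and T: "T \<subseteq> L \<union> R"
    and A [measurable]: "A \<in> sets (PM L)" and B [measurable]: "B \<in> sets (PM R)"
  shows "emeasure (parity_copula c T (L \<union> R))
      {x \<in> space (PM (L \<union> R)). restrict x L \<in> A \<and> restrict x R \<in> B} =
    (\<integral>\<^sup>+x. indicator A x * emeasure (parity_copula (c * parity (T \<inter> L) x) (T \<inter> R) R) B \<partial>indep_copula L)"
proof -
  let ?S = "{x \<in> space (PM (L \<union> R)). restrict x L \<in> A \<and> restrict x R \<in> B}"
  note [measurable] = parity_measurable[OF T] parity_measurable[of "T \<inter> R" R, OF Int_lower2]
    measurable_restrict_PM[of L "L \<union> R"] measurable_restrict_PM[of R "L \<union> R"]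
  have S [measurable]: "?S \<in> sets (PM (L \<union> R))"
    by measurable
  have "emeasure (parity_copula c T (L \<union> R)) ?S =
      (\<integral>\<^sup>+x. ennreal (1 + c * parity T x) * indicator ?S x \<partial>indep_copula (L \<union> R))"
    unfolding parity_copula_def by (subst emeasure_density) auto
  also have "\<dots> = (\<integral>\<^sup>+x. (\<integral>\<^sup>+y. ennreal (1 + c * parity T (merge L R (x, y))) *
      indicator ?S (merge L R (x, y)) \<partial>indep_copula R) \<partial>indep_copula L)"
    unfolding indep_copula_def
    using LR by (intro unifs.product_nn_integral_fold) (auto simp: indep_copula_def[symmetric])
  also have "\<dots> = (\<integral>\<^sup>+x. (\<integral>\<^sup>+y. indicator A x * (ennreal (1 + (c * parity (T \<inter> L) x) * parity (T \<inter> R) y) *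
      indicator B y) \<partial>indep_copula R) \<partial>indep_copula L)"
    using LR
    by (intro nn_integral_cong)
       (auto simp: parity_merge[OF LR T] space_PM extensional_restrict mult.assoc split: split_indicator)
  also have "\<dots> = (\<integral>\<^sup>+x. indicator A x * emeasure (parity_copula (c * parity (T \<inter> L) x) (T \<inter> R) R) B \<partial>indep_copula L)"
    unfolding parity_copula_def
    by (intro nn_integral_cong, subst nn_integral_cmult) (auto simp: emeasure_density)
  finally show ?thesis .
qed

text \<open>The measure is not normalised here. In the split with \<open>T \<subseteq> L\<close>,
  the factor \<open>1 + c\<close>, taken at \<open>c * parity T x\<close>, is the density of the
  margin on \<open>L\<close>.\<close>

lemma emeasure_parity_copula_empty:
  "A \<in> sets (PM R) \<Longrightarrow> emeasure (parity_copula c {} R) A = ennreal (1 + c) * emeasure (indep_copula R) A"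
  by (simp add: parity_copula_def parity_def emeasure_density_const)

text \<open>Take \<open>B\<close> to be the whole space in
  \<open>emeasure_parity_copula_split\<close>. If \<open>T\<close> leaves \<open>L\<close>, the
  inner measure has mass 1 and the perturbation disappears; otherwise its mass is the density on
  \<open>L\<close>.\<close>

lemma marg_parity_copula:
  assumes J: "finite J" and L: "L \<subseteq> J" and T: "T \<subseteq> J" "T \<noteq> {}" and c: "\<bar>c\<bar> \<le> 1"
  shows "marg L (parity_copula c T J) = (if T \<subseteq> L then parity_copula c T L else indep_copula L)"
proof (rule measure_eqI)
  fix A assume "A \<in> sets (marg L (parity_copula c T J))"
  then have A [measurable]: "A \<in> sets (PM L)" by (simp add: marg_def)
  define R where "R = J - L"
  have fin: "finite L" "finite R" and J_eq: "J = L \<union> R" and disj: "L \<inter> R = {}"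
    using J L finite_subset by (auto simp: R_def)
  have [measurable]: "(\<lambda>x. restrict x L) \<in> measurable (parity_copula c T (L \<union> R)) (PM L)"
    by (simp cong: measurable_cong_sets)
  have "emeasure (marg L (parity_copula c T J)) A =
      emeasure (parity_copula c T (L \<union> R))
        {x \<in> space (PM (L \<union> R)). restrict x L \<in> A \<and> restrict x R \<in> space (PM R)}"
    unfolding marg_def using L
    by (subst emeasure_distr)
       (auto intro!: arg_cong2[where f=emeasure] simp: J_eq space_PM)
  also have "\<dots> = (\<integral>\<^sup>+x. indicator A x *
      emeasure (parity_copula (c * parity (T \<inter> L) x) (T \<inter> R) R) (space (PM R)) \<partial>indep_copula L)"
    using T J_eq by (intro emeasure_parity_copula_split fin disj) auto
  also have "\<dots> = emeasure (if T \<subseteq> L then parity_copula c T L else indep_copula L) A"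
  proof (cases "T \<subseteq> L")
    case True
    note [measurable] = parity_measurable[OF True]
    have "T \<inter> L = T" "T \<inter> R = {}" using True disj by auto
    then show ?thesis
      using True prob_space.emeasure_space_1[OF prob_space_indep_copula[of R]]
      by (simp add: emeasure_parity_copula_empty)
         (simp add: parity_copula_def emeasure_density mult.commute)
  next
    case False
    then have "T \<inter> R \<noteq> {}" using T J_eq by auto
    then have "prob_space (parity_copula (c * parity (T \<inter> L) x) (T \<inter> R) R)" for x
      using c fin by (intro prob_space_parity_copula) (auto simp: abs_mult)
    from prob_space.emeasure_space_1[OF this] show ?thesis
      using False by (simp add: nn_integral_indicator)
  qed
  finally show "emeasure (marg L (parity_copula c T J)) A = \<dots>" .
qed (simp add: marg_def)

lemma marg_indep_copula:
  assumes "finite J" "L \<subseteq> J" "J \<noteq> {}"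
  shows "marg L (indep_copula J) = indep_copula L"
  \<comment> \<open>Independence is the case \<open>c = 0\<close>, \<open>T = J\<close>;
    \<open>J \<noteq> {}\<close> supplies the nonempty \<open>T\<close>.\<close>
  using marg_parity_copula[of J L J 0] assms by auto

text \<open>If \<open>T \<subseteq> L\<close>, the whole density belongs to the margin and the
  conditional law is independence. Otherwise the inner measure of
  \<open>emeasure_parity_copula_split\<close> is a probability measure and serves as the
  kernel.\<close>

lemma is_rcd_parity_copula:
  assumes LR: "finite L" "finite R" "L \<inter> R = {}" "R \<noteq> {}" and T: "T \<subseteq> L \<union> R" "T \<noteq> {}"
    and c: "\<bar>c\<bar> \<le> 1"
  shows "is_rcd (parity_copula c T (L \<union> R)) L R
    (\<lambda>t. if T \<subseteq> L then indep_copula R else parity_copula (c * parity (T \<inter> L) t) (T \<inter> R) R)"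
    (is "is_rcd _ _ _ ?K")
proof -
  note [measurable] = parity_measurable[of "T \<inter> L" L, OF Int_lower2]
  have K_prob: "indep_copula R \<in> space (prob_algebra (PM R))"
    by (simp add: space_prob_algebra prob_space_indep_copula)
  have "?K \<in> measurable (PM L) (prob_algebra (PM R))"
  proof (cases "T \<subseteq> L")
    case False
    then have ne: "T \<inter> R \<noteq> {}" using T by auto
    \<comment> \<open>A parity takes only the values 1 and -1, so the kernel switches between two
      constant measures on a measurable set.\<close>
    have K_eq: "?K = (\<lambda>t. if parity (T \<inter> L) t = 1 then parity_copula c (T \<inter> R) R
        else parity_copula (- c) (T \<inter> R) R)"
      using False parity_cases[of "T \<inter> L"] by fastforce
    have "parity_copula b (T \<inter> R) R \<in> space (prob_algebra (PM R))" if "\<bar>b\<bar> \<le> 1" for b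
      using that LR ne by (simp add: space_prob_algebra prob_space_parity_copula)
    then show ?thesis
      unfolding K_eq using c by (intro measurable_If measurable_const) auto
  qed (use K_prob in simp)
  moreover have "emeasure (parity_copula c T (L \<union> R))
      {x \<in> space (parity_copula c T (L \<union> R)). restrict x L \<in> A \<and> restrict x R \<in> B} =
      (\<integral>\<^sup>+ t. indicator A t * emeasure (?K t) B \<partial>marg L (parity_copula c T (L \<union> R)))"
    if [measurable]: "A \<in> sets (PM L)" and B: "B \<in> sets (PM R)" for A B
  proof -
    have m: "marg L (parity_copula c T (L \<union> R)) = (if T \<subseteq> L then parity_copula c T L else indep_copula L)"
      using LR T c by (intro marg_parity_copula) auto
    note split = emeasure_parity_copula_split[OF LR(1-3) T(1) that, of c]
    show ?thesis
    proof (cases "T \<subseteq> L")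
      case True
      note [measurable] = parity_measurable[OF True]
      have "T \<inter> L = T" "T \<inter> R = {}" using True LR by auto
      with True show ?thesis
        by (simp add: m split emeasure_parity_copula_empty B)
           (simp add: parity_copula_def nn_integral_density mult_ac)
    qed (simp add: m split)
  qed
  ultimately show ?thesis
    by (simp add: is_rcd_def)
qed

section \<open>Uniqueness of conditional distributions\<close>

text \<open>A countable generator is wanted so that almost sure identities on its members hold
  simultaneously off one null set.\<close>

lemma sets_borel_rational_atMost:
  "sets (borel :: real measure) = sigma_sets UNIV (atMost ` \<rat>)"
proof -
  have "borel = sigma UNIV (atMost ` (\<rat> :: real set))"
  proof (rule borel_eq_sigmaI1[OF borel_eq_atMost])
    fix X :: "real set" assume "X \<in> range atMost"
    then obtain x where X: "X = {..x}" by auto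
    have *: "{..x} = (\<Inter>q\<in>\<rat> \<inter> {x<..}. {..q})"
    proof (intro equalityI subsetI)
      fix y assume y: "y \<in> (\<Inter>q\<in>\<rat> \<inter> {x<..}. {..q})"
      show "y \<in> {..x}"
      proof (rule ccontr)
        assume "y \<notin> {..x}"
        then obtain q where "q \<in> \<rat>" "x < q" "q < y" using Rats_dense_in_real[of x y] by auto
        with y show False by force
      qed
    qed auto
    obtain q where "q \<in> \<rat>" "x < q" using Rats_dense_in_real[of x "x + 1"] by auto
    then have ne: "\<rat> \<inter> {x<..} \<noteq> {}" by auto
    have "{..x} \<in> sets (sigma UNIV (atMost ` (\<rat> :: real set)))"
      unfolding * using ne
      by (intro sets.countable_INT'') (auto intro: countable_subset[OF _ countable_rat] sigma_sets_top)
    then show "X \<in> sets (sigma UNIV (atMost ` \<rat>))" unfolding X .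
  qed auto
  then have "sets (borel :: real measure) = sets (sigma UNIV (atMost ` \<rat>))" by (rule arg_cong)
  then show ?thesis by (simp add: sets_measure_of)
qed

lemma sets_PM_rational_box:
  assumes "finite R"
  shows "sets (PM R) = sigma_sets (space (PM R))
    ((\<lambda>q. {x \<in> space (PM R). \<forall>j\<in>R. x j \<le> q j}) ` (R \<rightarrow>\<^sub>E \<rat>))"
proof -
  let ?E = "atMost ` (\<rat> :: real set)"
  \<comment> \<open>The form of generator that \<open>sets_PiM_sigma\<close> produces; the choice
    \<open>J = {R}\<close> there makes each member constrain all coordinates of \<open>R\<close> at
    once.\<close>
  let ?P = "{{f \<in> (\<Pi>\<^sub>E i\<in>R. UNIV). \<forall>i\<in>j. f i \<in> A i} | A j. j \<in> {R} \<and> A \<in> Pi j (\<lambda>_. ?E)}"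
  have sp: "space (PM R) = (\<Pi>\<^sub>E i\<in>R. UNIV)" by (simp add: PM_def space_PiM)
  have "sets (PM R) = sets (\<Pi>\<^sub>M i\<in>R. sigma UNIV ?E)"
    unfolding PM_def by (intro sets_PiM_cong) (auto simp: sets_borel_rational_atMost)
  also have "\<dots> = sets (sigma (\<Pi>\<^sub>E i\<in>R. UNIV) ?P)"
  proof (rule sets_PiM_sigma[where \<Omega>="\<lambda>_. UNIV" and E="\<lambda>_. ?E" and J="{R}" and I=R])
    have "\<Union>?E = UNIV"
    proof -
      have "x \<in> \<Union>?E" for x :: real
        using Rats_dense_in_real[of x "x + 1"] by (auto intro: less_imp_le)
      then show ?thesis by blast
    qed
    then show "\<exists>S\<subseteq>?E. countable S \<and> UNIV = \<Union>S"
      by (intro exI[of _ ?E]) (auto simp: countable_rat)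
  qed (use assms in auto)
  also have "?P = (\<lambda>q. {x \<in> space (PM R). \<forall>j\<in>R. x j \<le> q j}) ` (R \<rightarrow>\<^sub>E \<rat>)"
  proof (intro equalityI subsetI)
    fix X assume "X \<in> ?P"
    then obtain A where A: "A \<in> Pi R (\<lambda>_. ?E)" "X = {f \<in> (\<Pi>\<^sub>E i\<in>R. UNIV). \<forall>i\<in>R. f i \<in> A i}" by auto
    then have "\<forall>j\<in>R. \<exists>q\<in>\<rat>. A j = {..q}" by (auto simp: Pi_def)
    then obtain q where "\<forall>j\<in>R. q j \<in> \<rat> \<and> A j = {..q j}" by metis
    with A show "X \<in> (\<lambda>q. {x \<in> space (PM R). \<forall>j\<in>R. x j \<le> q j}) ` (R \<rightarrow>\<^sub>E \<rat>)"
      by (intro image_eqI[of _ _ "restrict q R"]) (auto simp: sp)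
  next
    fix X assume "X \<in> (\<lambda>q. {x \<in> space (PM R). \<forall>j\<in>R. x j \<le> q j}) ` (R \<rightarrow>\<^sub>E \<rat>)"
    then obtain q where "q \<in> R \<rightarrow>\<^sub>E \<rat>" "X = {x \<in> space (PM R). \<forall>j\<in>R. x j \<le> q j}" by auto
    then show "X \<in> ?P"
      by (intro CollectI exI[of _ "\<lambda>j. {..q j}"] exI[of _ R]) (auto simp: sp)
  qed
  finally show ?thesis
    by (subst (asm) sets_measure_of) (auto simp: sp)
qed

lemma box_in_sets: "finite R \<Longrightarrow> {x \<in> space (PM R). \<forall>j\<in>R. x j \<le> q j} \<in> sets (PM R)"
  by (intro sets.sets_Collect_finite_All) auto

text \<open>Rational lower boxes are stable under intersection, generate the product sets and
  exhaust the space through integer corners, so Dynkin's argument applies.\<close>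

lemma measure_eqI_cdf_on:
  assumes M: "prob_space M" "sets M = sets (PM R)" and N: "prob_space N" "sets N = sets (PM R)"
    and R: "finite R" and eq: "\<And>q. q \<in> R \<rightarrow>\<^sub>E \<rat> \<Longrightarrow> cdf_on R M q = cdf_on R N q"
  shows "M = N"
proof -
  interpret M: prob_space M by fact
  interpret N: prob_space N by fact
  show ?thesis
  proof (rule measure_eqI_generator_eq)
    let ?box = "\<lambda>q. {x \<in> space (PM R). \<forall>j\<in>R. x j \<le> q j}"
    let ?E = "?box ` (R \<rightarrow>\<^sub>E \<rat>)"
    show "Int_stable ?E"
    proof (rule Int_stableI)
      fix X Y assume "X \<in> ?E" "Y \<in> ?E"
      then obtain p q where pq: "p \<in> R \<rightarrow>\<^sub>E \<rat>" "q \<in> R \<rightarrow>\<^sub>E \<rat>" and XY: "X = ?box p" "Y = ?box q" by auto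
      have "X \<inter> Y = ?box (\<lambda>j\<in>R. min (p j) (q j))" unfolding XY by auto
      moreover have "(\<lambda>j\<in>R. min (p j) (q j)) \<in> R \<rightarrow>\<^sub>E \<rat>" using pq by (auto simp: min_def)
      ultimately show "X \<inter> Y \<in> ?E" by blast
    qed
    show "sets M = sigma_sets (space (PM R)) ?E" "sets N = sigma_sets (space (PM R)) ?E"
      using M N sets_PM_rational_box[OF R] by auto
    show "emeasure M X = emeasure N X" if "X \<in> ?E" for X
      using that eq by (auto simp: cdf_on_def M.emeasure_eq_measure N.emeasure_eq_measure)
    show "range (\<lambda>n. ?box (\<lambda>j\<in>R. real n)) \<subseteq> ?E"
    proof -
      have "(\<lambda>j\<in>R. real n) \<in> R \<rightarrow>\<^sub>E \<rat>" for n by simp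
      then show ?thesis by blast
    qed
    show "(\<Union>n. ?box (\<lambda>j\<in>R. real n)) = space (PM R)"
    proof (intro equalityI subsetI)
      fix x assume x: "x \<in> space (PM R)"
      obtain n where n: "(\<Sum>j\<in>R. \<bar>x j\<bar>) \<le> real n" using real_arch_simple by blast
      have "x j \<le> real n" if "j \<in> R" for j
        using member_le_sum[OF that, of "\<lambda>j. \<bar>x j\<bar>"] n R by auto
      with x show "x \<in> (\<Union>n. ?box (\<lambda>j\<in>R. real n))" by auto
    qed auto
  qed (auto simp: M.emeasure_eq_measure)
qed

text \<open>The strict bound at 0 holds since points are null under the uniform law. In
  \<open>copula_eqI\<close> it justifies clamping a negative bound to 0: both events are then
  null.\<close>

lemma AE_copula:
  assumes J: "finite J" and cop: "is_copula J \<nu>"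
  shows "AE x in \<nu>. \<forall>j\<in>J. 0 < x j \<and> x j \<le> 1"
proof (rule AE_finite_allI[OF J])
  fix j assume j: "j \<in> J"
  have s: "sets \<nu> = sets (PM J)" and d: "distr \<nu> borel (\<lambda>x. x j) = unif"
    using cop j by (auto simp: is_copula_def unif_def)
  have m: "(\<lambda>x. x j) \<in> borel_measurable \<nu>"
    using j measurable_component_PM[of j J] by (simp cong: measurable_cong_sets add: s)
  have "AE x in unif. x \<noteq> 0"
    using emeasure_unif_singleton[of 0] by (intro AE_I[of _ _ "{0}"]) auto
  then have "AE x in unif. 0 < x \<and> x \<le> 1"
    using AE_unif by eventually_elim auto
  then show "AE x in \<nu>. 0 < x j \<and> x j \<le> 1"
    unfolding d[symmetric] by (rule AE_distrD[OF m])
qed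

text \<open>Copulas are prescribed on the unit cube only, whereas \<open>measure_eqI_cdf_on\<close>
  tests all rational points. Clamping a point into the cube changes its box by a null set.\<close>

lemma copula_eqI:
  assumes J: "finite J" and cop: "is_copula J \<nu>" "is_copula J \<nu>'"
    and eq: "\<And>u. u \<in> unit_cube J \<Longrightarrow> cdf_on J \<nu> u = cdf_on J \<nu>' u"
  shows "\<nu> = \<nu>'"
proof (rule measure_eqI_cdf_on)
  fix q :: "nat \<Rightarrow> real"
  define u where "u j = max 0 (min 1 (q j))" for j
  have clamp: "cdf_on J M q = cdf_on J M u" if M: "is_copula J M" for M
  proof -
    interpret prob_space M using M by (simp add: is_copula_def)
    have s: "sets M = sets (PM J)" using M by (simp add: is_copula_def)
    show ?thesis
      unfolding cdf_on_def
    proof (rule finite_measure_eq_AE)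
      show "AE x in M. (x \<in> {x \<in> space (PM J). \<forall>j\<in>J. x j \<le> q j}) = (x \<in> {x \<in> space (PM J). \<forall>j\<in>J. x j \<le> u j})"
        using AE_copula[OF J M] by eventually_elim (force simp: u_def)
    qed (auto simp: s box_in_sets J)
  qed
  have "u \<in> unit_cube J" by (auto simp: unit_cube_def u_def)
  then show "cdf_on J \<nu> q = cdf_on J \<nu>' q"
    using clamp cop eq by simp
qed (use assms in \<open>auto simp: is_copula_def\<close>)

text \<open>Needed because \<open>pvc\<close> picks kernels by \<open>SOME\<close> and
  \<open>Cc\<close> quantifies over all of them. For fixed \<open>B\<close> both kernels are
  densities of the same measure on \<open>L\<close>; countably many rational boxes then determine
  the kernel.\<close>

lemma is_rcd_unique:
  assumes K: "is_rcd \<nu> L R K" and K': "is_rcd \<nu> L R K'"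
    and \<nu>: "prob_space (marg L \<nu>)" and R: "finite R"
  shows "AE t in marg L \<nu>. K t = K' t"
proof -
  interpret prob_space "marg L \<nu>" by fact
  have sm [measurable_cong, simp]: "sets (marg L \<nu>) = sets (PM L)" by (simp add: marg_def)
  have [simp]: "space (marg L \<nu>) = space (PM L)" by (simp add: marg_def)
  have Km [measurable]: "K \<in> measurable (PM L) (prob_algebra (PM R))" "K' \<in> measurable (PM L) (prob_algebra (PM R))"
    using K K' by (auto simp: is_rcd_def)
  note [measurable] = measurable_emeasure_kernel[OF measurable_prob_algebraD[OF Km(1)]]
    measurable_emeasure_kernel[OF measurable_prob_algebraD[OF Km(2)]]
  let ?box = "\<lambda>q. {x \<in> space (PM R). \<forall>j\<in>R. x j \<le> q j}"
  have "AE t in marg L \<nu>. emeasure (K t) B = emeasure (K' t) B" if B [measurable]: "B \<in> sets (PM R)" for B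
  proof (rule density_unique)
    show "density (marg L \<nu>) (\<lambda>t. emeasure (K t) B) = density (marg L \<nu>) (\<lambda>t. emeasure (K' t) B)"
    proof (rule measure_eqI)
      fix A assume "A \<in> sets (density (marg L \<nu>) (\<lambda>t. emeasure (K t) B))"
      then have A [measurable]: "A \<in> sets (PM L)" by simp
      have rcd: "(\<integral>\<^sup>+ t. indicator A t * emeasure (H t) B \<partial>marg L \<nu>) =
          emeasure \<nu> {x \<in> space \<nu>. restrict x L \<in> A \<and> restrict x R \<in> B}" if "is_rcd \<nu> L R H" for H
        using that A B unfolding is_rcd_def by simp
      show "emeasure (density (marg L \<nu>) (\<lambda>t. emeasure (K t) B)) A =
          emeasure (density (marg L \<nu>) (\<lambda>t. emeasure (K' t) B)) A"
        using rcd[OF K] rcd[OF K'] by (simp add: emeasure_density mult.commute)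
    qed simp
  qed measurable
  then have "AE t in marg L \<nu>. \<forall>q\<in>R \<rightarrow>\<^sub>E \<rat>. emeasure (K t) (?box q) = emeasure (K' t) (?box q)"
    using R by (subst AE_ball_countable) (auto intro!: countable_PiE countable_rat box_in_sets)
  then show ?thesis
    using AE_space
  proof eventually_elim
    fix t assume eq: "\<forall>q\<in>R \<rightarrow>\<^sub>E \<rat>. emeasure (K t) (?box q) = emeasure (K' t) (?box q)"
      and t: "t \<in> space (marg L \<nu>)"
    have "K t \<in> space (prob_algebra (PM R))" "K' t \<in> space (prob_algebra (PM R))"
      using t by (auto intro: measurable_space[OF Km(1)] measurable_space[OF Km(2)])
    then show "K t = K' t"
      using R eq by (intro measure_eqI_cdf_on) (auto simp: space_prob_algebra cdf_on_def measure_def)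
  qed
qed

lemma marg_marg:
  assumes "sets \<nu> = sets (PM J)" "L \<subseteq> J'" "J' \<subseteq> J"
  shows "marg L (marg J' \<nu>) = marg L \<nu>"
proof -
  have "restrict (restrict x J') L = restrict x L" for x :: "nat \<Rightarrow> real"
    using assms by (auto simp: restrict_def fun_eq_iff)
  moreover have "(\<lambda>x. restrict x J') \<in> measurable \<nu> (PM J')"
    using assms by (simp cong: measurable_cong_sets add: measurable_restrict_PM)
  ultimately show ?thesis
    unfolding marg_def using assms by (subst distr_distr) (auto simp: comp_def measurable_restrict_PM)
qed

text \<open>The defining identity sees only the coordinates in \<open>L \<union> R\<close>. In
  \<open>Cc_parity_copula\<close> this leads from an arbitrary \<open>J\<close> to
  \<open>L \<union> {j}\<close>, where an explicit kernel is known.\<close>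

lemma is_rcd_marg:
  assumes s: "sets \<nu> = sets (PM J)" and sub: "L \<union> R \<subseteq> J'" "J' \<subseteq> J"
  shows "is_rcd (marg J' \<nu>) L R K \<longleftrightarrow> is_rcd \<nu> L R K"
proof -
  have [simp]: "space (marg J' \<nu>) = space (PM J')" by (simp add: marg_def)
  have sp: "space \<nu> = space (PM J)" by (rule sets_eq_imp_space_eq) fact
  have m: "(\<lambda>x. restrict x J') \<in> measurable \<nu> (PM J')"
    using s sub by (simp cong: measurable_cong_sets add: measurable_restrict_PM)
  have "emeasure (marg J' \<nu>) {x \<in> space (PM J'). restrict x L \<in> A \<and> restrict x R \<in> B} =
      emeasure \<nu> {x \<in> space \<nu>. restrict x L \<in> A \<and> restrict x R \<in> B}"
    if "A \<in> sets (PM L)" "B \<in> sets (PM R)" for A B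
  proof -
    have "restrict (restrict x J') L = restrict x L" "restrict (restrict x J') R = restrict x R"
      for x :: "nat \<Rightarrow> real"
      using sub by (auto simp: restrict_def fun_eq_iff subset_iff)
    moreover have "{x \<in> space (PM J'). restrict x L \<in> A \<and> restrict x R \<in> B} \<in> sets (PM J')"
      using sub that by (intro sets.sets_Collect_conj measurable_sets_Collect[OF measurable_restrict_PM]) auto
    ultimately show ?thesis
      unfolding marg_def using m
      by (subst emeasure_distr) (auto intro!: arg_cong2[where f=emeasure] simp: space_PM that)
  qed
  moreover have "marg L (marg J' \<nu>) = marg L \<nu>"
    using sub by (intro marg_marg[OF s]) auto
  ultimately show ?thesis
    by (simp add: is_rcd_def)
qed

section \<open>Conditional copulas and continuity\<close>

lemma cdf_on_parity_copula:
  assumes "finite J" "T \<subseteq> J" "\<bar>c\<bar> \<le> 1"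
  shows "cdf_on J (parity_copula c T J) u = (\<Prod>j\<in>J. max 0 (min 1 (u j))) +
    c * (\<Prod>j\<in>J. if j \<in> T then (\<integral>x. half_sign x * indicator {..u j} x \<partial>unif) else max 0 (min 1 (u j)))"
proof -
  have "{x \<in> space (PM J). \<forall>j\<in>J. x j \<le> u j} = PiE J (\<lambda>j. {..u j})"
    by (auto simp: space_PM PiE_def)
  then show ?thesis
    using measure_parity_copula_box[OF assms, of "\<lambda>j. {..u j}"]
    unfolding measure_unif_atMost by (simp add: cdf_on_def)
qed

lemma cdf_on_indep_copula:
  "finite J \<Longrightarrow> cdf_on J (indep_copula J) u = (\<Prod>j\<in>J. max 0 (min 1 (u j)))"
  using cdf_on_parity_copula[of J "{}" 0 u] by simp

lemma distr_component_indep_copula: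
  "j \<in> J \<Longrightarrow> distr (indep_copula J) borel (\<lambda>x. x j) = unif"
proof -
  assume j: "j \<in> J"
  have "distr (PiM J (\<lambda>_. unif)) unif (\<lambda>x. x j) = unif"
    using j by (intro distr_PiM_component) (auto intro: unif.prob_space_axioms)
  moreover have "distr (PiM J (\<lambda>_. unif)) unif (\<lambda>x. x j) = distr (indep_copula J) borel (\<lambda>x. x j)"
    by (intro distr_cong) (auto simp: indep_copula_def)
  ultimately show ?thesis by simp
qed

lemma distr_component_marg:
  assumes s: "sets \<nu> = sets (PM J)" and j: "j \<in> L" "L \<subseteq> J"
  shows "distr (marg L \<nu>) borel (\<lambda>x. x j) = distr \<nu> borel (\<lambda>x. x j)"
proof -
  have "(\<lambda>x. restrict x L) \<in> measurable \<nu> (PM L)"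
    using s j by (simp cong: measurable_cong_sets add: measurable_restrict_PM)
  with j show ?thesis
    unfolding marg_def by (subst distr_distr) (auto simp: comp_def)
qed

lemma is_copula_indep_copula: "is_copula J (indep_copula J)"
  by (auto simp: is_copula_def prob_space_indep_copula distr_component_indep_copula unif_def[symmetric])

text \<open>Two elements keep \<open>T\<close> out of every \<open>{j}\<close>, so each univariate
  margin loses the perturbation.\<close>

lemma is_copula_parity_copula:
  assumes J: "finite J" and T: "T \<subseteq> J" "2 \<le> card T" and c: "\<bar>c\<bar> \<le> 1"
  shows "is_copula J (parity_copula c T J)"
proof -
  have T': "T \<noteq> {}" using T by auto
  have "distr (parity_copula c T J) borel (\<lambda>x. x j) = unif" if j: "j \<in> J" for j
  proof -
    have "\<not> T \<subseteq> {j}" using T card_mono[of "{j}" T] by auto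
    then have "marg {j} (parity_copula c T J) = indep_copula {j}"
      using j T T' by (subst marg_parity_copula[OF J _ _ _ c]) auto
    then show ?thesis
      using distr_component_marg[of "parity_copula c T J" J j "{j}"] j
      by (simp add: distr_component_indep_copula)
  qed
  then show ?thesis
    using prob_space_parity_copula[OF J T(1) T' c] by (simp add: is_copula_def unif_def[symmetric])
qed

lemma cond_df_copula:
  assumes "is_copula R (K t)" "j \<in> R"
  shows "cond_df K j v t = max 0 (min 1 v)"
proof -
  have s: "sets (K t) = sets (PM R)" using assms by (simp add: is_copula_def)
  have m: "(\<lambda>x. x j) \<in> borel_measurable (K t)"
    using assms by (simp cong: measurable_cong_sets add: s measurable_component_PM)
  have "max 0 (min 1 v) = measure (distr (K t) borel (\<lambda>x. x j)) {..v}"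
    using assms by (simp add: is_copula_def unif_def[symmetric] measure_unif_atMost)
  also have "\<dots> = cond_df K j v t"
    using m by (subst measure_distr) (auto simp: cond_df_def intro!: arg_cong2[where f=measure])
  finally show ?thesis by simp
qed

text \<open>For uniform margins the probability integral transform is clamping to the unit interval,
  which is almost surely the identity.\<close>

lemma cond_copula_copula:
  assumes R: "finite R" and cop: "is_copula R (K t)"
  shows "cond_copula R K t = K t"
proof -
  have s: "sets (K t) = sets (PM R)" using cop by (simp add: is_copula_def)
  have sp: "space (K t) = space (PM R)" by (rule sets_eq_imp_space_eq) fact
  have "(\<lambda>y. restrict (\<lambda>j. max 0 (min 1 (y j))) R) \<in> measurable (PM R) (PM R)"
    unfolding PM_def by (intro measurable_restrict borel_measurable_max borel_measurable_min) auto
  then have m: "(\<lambda>y. restrict (\<lambda>j. max 0 (min 1 (y j))) R) \<in> measurable (K t) (PM R)"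
    by (simp cong: measurable_cong_sets add: s)
  have "cond_copula R K t = distr (K t) (PM R) (\<lambda>y. restrict (\<lambda>j. max 0 (min 1 (y j))) R)"
    unfolding cond_copula_def using cop
    by (intro distr_cong) (auto simp: cond_df_copula[where K=K and t=t and R=R] intro!: restrict_ext)
  also have "\<dots> = distr (K t) (PM R) (\<lambda>y. y)"
  proof (rule distr_cong_AE)
    show "AE y in K t. restrict (\<lambda>j. max 0 (min 1 (y j))) R = y"
      using AE_copula[OF R cop] AE_space[of "K t"]
    proof eventually_elim
      case (elim y)
      then have "y \<in> extensional R" by (simp add: sp space_PM)
      with elim show ?case by (auto simp: fun_eq_iff restrict_def extensional_def)
    qed
    show "(\<lambda>y. y) \<in> K t \<rightarrow>\<^sub>M PM R"
      by (intro measurable_ident_sets s)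
  qed (use m in auto)
  also have "\<dots> = K t" using s by (simp add: distr_id2)
  finally show ?thesis .
qed

text \<open>The law has a density with respect to the uniform law, hence no atoms. For
  \<open>T = {j}\<close> it need not be uniform, so \<open>cond_df_copula\<close> would not
  suffice.\<close>

lemma isCont_cond_df_parity_copula:
  assumes K: "K t = parity_copula c T {j}" and T: "T \<subseteq> {j}" and pr: "prob_space (K t)"
  shows "isCont (\<lambda>v. cond_df K j v t) u"
proof -
  note [measurable] = parity_measurable[OF T]
  interpret prob_space "K t" by fact
  have m: "(\<lambda>x. x j) \<in> borel_measurable (K t)"
    unfolding K by (simp cong: measurable_cong_sets)
  interpret D: real_distribution "distr (K t) borel (\<lambda>x. x j)"
    using m by (intro real_distribution.intro prob_space_distr) (simp_all add: real_distribution_axioms_def)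
  have "emeasure (indep_copula {j}) {x \<in> space (PM {j}). x j = u} = emeasure unif {u}"
    unfolding distr_component_indep_copula[of j "{j}", OF singletonI, symmetric]
    using measurable_component_PM[of j "{j}"]
    by (subst emeasure_distr)
       (auto intro!: arg_cong2[where f=emeasure] cong: measurable_cong_sets)
  then have "{x \<in> space (PM {j}). x j = u} \<in> null_sets (indep_copula {j})"
    by (auto simp: emeasure_unif_singleton intro!: null_setsI)
  then have "{x \<in> space (PM {j}). x j = u} \<in> null_sets (K t)"
    using absolutely_continuousI_density[of "\<lambda>x. ennreal (1 + c * parity T x)" "indep_copula {j}"]
    unfolding K parity_copula_def absolutely_continuous_def by auto
  then have "measure (K t) {x \<in> space (PM {j}). x j = u} = 0"
    by (simp add: measure_eq_0_null_sets)
  moreover have "{x \<in> space (PM {j}). x j = u} = (\<lambda>x. x j) -` {u} \<inter> space (K t)"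
    by (auto simp: K)
  ultimately have "isCont (cdf (distr (K t) borel (\<lambda>x. x j))) u"
    unfolding D.isCont_cdf using m by (simp add: measure_distr)
  moreover have "cdf (distr (K t) borel (\<lambda>x. x j)) = (\<lambda>v. cond_df K j v t)"
    unfolding cdf_def cond_df_def fun_eq_iff using m
    by (auto simp: measure_distr intro!: arg_cong2[where f=measure])
  ultimately show ?thesis by simp
qed

text \<open>On the margin \<open>L \<union> {j}\<close> an arbitrary kernel agrees almost everywhere
  with the explicit one, whose distribution functions are continuous.\<close>

lemma Cc_parity_copula:
  assumes T: "T \<subseteq> {1..d}" "2 \<le> card T" and c: "\<bar>c\<bar> \<le> 1"
  shows "Cc d (parity_copula c T {1..d})"
  unfolding Cc_def
proof (intro conjI allI impI; (elim conjE)?)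
  let ?\<mu> = "parity_copula c T {1..d}"
  show "is_copula {1..d} ?\<mu>"
    using T c by (intro is_copula_parity_copula) auto
  fix J L j K
  assume J: "J \<subseteq> {1..d}" and L: "L \<subseteq> J" and j: "j \<in> J - L" and K: "is_rcd (marg J ?\<mu>) L {j} K"
  have fin: "finite L" using J L by (intro finite_subset[of L "{1..d}"]) auto
  have sub: "L \<union> {j} \<subseteq> J" using L j by auto
  have T': "T \<noteq> {}" using T by auto
  \<comment> \<open>Independence is written with \<open>c = 0\<close> and index set
    \<open>{j}\<close>, so that one pair \<open>b\<close>, \<open>S\<close> with \<open>S\<close>
    nonempty covers both cases.\<close>
  have "marg (L \<union> {j}) ?\<mu> = (if T \<subseteq> L \<union> {j} then parity_copula c T (L \<union> {j})
      else parity_copula 0 {j} (L \<union> {j}))"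
    unfolding parity_copula_0 using sub J T T' c by (intro marg_parity_copula) auto
  then obtain b S where bS: "\<bar>b\<bar> \<le> 1" "S \<subseteq> L \<union> {j}" "S \<noteq> {}"
    and m: "marg (L \<union> {j}) ?\<mu> = parity_copula b S (L \<union> {j})"
    using c T' that[of c T] that[of 0 "{j}"] by (cases "T \<subseteq> L \<union> {j}") auto
  define H where "H t = (if S \<subseteq> L then indep_copula {j}
    else parity_copula (b * parity (S \<inter> L) t) (S \<inter> {j}) {j})" for t
  have H: "is_rcd (marg (L \<union> {j}) ?\<mu>) L {j} H"
    unfolding m H_def using bS fin j by (intro is_rcd_parity_copula) auto
  have K': "is_rcd (marg (L \<union> {j}) ?\<mu>) L {j} K"
    using K is_rcd_marg[OF sets_parity_copula sub J]
      is_rcd_marg[OF sets_parity_copula subset_refl subset_trans[OF sub J]]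
    by blast
  have mm: "marg L (marg (L \<union> {j}) ?\<mu>) = marg L ?\<mu>"
    using sub J by (intro marg_marg[where J="{1..d}"]) auto
  have "prob_space (marg L ?\<mu>)"
  proof -
    have "marg L ?\<mu> = (if T \<subseteq> L then parity_copula c T L else indep_copula L)"
      using J L T T' c by (intro marg_parity_copula) auto
    then show ?thesis
      using fin T' c by (auto intro: prob_space_parity_copula prob_space_indep_copula)
  qed
  then have "AE t in marg L ?\<mu>. K t = H t"
    using is_rcd_unique[OF K' H] unfolding mm by simp
  then show "AE t in marg L ?\<mu>. \<forall>u. isCont (\<lambda>v. cond_df K j v t) u"
  proof eventually_elim
    case (elim t)
    \<comment> \<open>The same device for the kernel; a nonempty \<open>S'\<close> is what
      \<open>prob_space_parity_copula\<close> asks for.\<close>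
    have "\<exists>b' S'. \<bar>b'\<bar> \<le> 1 \<and> S' \<subseteq> {j} \<and> S' \<noteq> {} \<and> H t = parity_copula b' S' {j}"
    proof (cases "S \<subseteq> L")
      case True
      then show ?thesis
        by (intro exI[of _ 0] exI[of _ "{j}"]) (simp add: H_def)
    next
      case False
      with bS show ?thesis
        by (intro exI[of _ "b * parity (S \<inter> L) t"] exI[of _ "S \<inter> {j}"]) (auto simp: H_def abs_mult)
    qed
    then obtain b' S' where "\<bar>b'\<bar> \<le> 1" "S' \<subseteq> {j}" "S' \<noteq> {}" and Kt: "K t = parity_copula b' S' {j}"
      using elim by auto
    then show ?case
      using isCont_cond_df_parity_copula[of K t b' S' j, OF Kt] prob_space_parity_copula[of "{j}" S' b'] by simp
  qed
qed

lemma is_rcd_indep_copula: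
  assumes "finite L" "finite R" "L \<inter> R = {}" "R \<noteq> {}"
  shows "is_rcd (indep_copula (L \<union> R)) L R (\<lambda>_. indep_copula R)"
  using is_rcd_parity_copula[of L R R 0] assms by (simp add: if_distrib cong: if_cong)

lemma is_rcd_indep_copula_unique:
  assumes "finite L" "finite R" "L \<inter> R = {}" "R \<noteq> {}" and K: "is_rcd (indep_copula (L \<union> R)) L R K"
  shows "AE t in indep_copula L. K t = indep_copula R"
proof -
  have m: "marg L (indep_copula (L \<union> R)) = indep_copula L"
    using assms by (intro marg_indep_copula) auto
  show ?thesis
    using is_rcd_unique[OF K is_rcd_indep_copula] assms(1-4) prob_space_indep_copula unfolding m by simp
qed

text \<open>Measurability is joint in condition and argument because \<open>cond_copula\<close>
  inserts the random coordinate \<open>y j\<close> for \<open>v\<close>.\<close>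

lemma cond_df_measurable [measurable]:
  assumes K [measurable]: "K \<in> measurable (PM L) (prob_algebra (PM R))" and j: "j \<in> R"
  shows "(\<lambda>(w, v). cond_df K j v w) \<in> borel_measurable (PM L \<Otimes>\<^sub>M borel)"
proof -
  note [measurable] = measurable_component_PM[OF j]
  have eq: "(SIGMA p:space (PM L \<Otimes>\<^sub>M borel). {z \<in> space (PM R). z j \<le> snd p}) =
      {q \<in> space ((PM L \<Otimes>\<^sub>M borel) \<Otimes>\<^sub>M PM R). snd q j \<le> snd (fst q)}"
    by (auto simp: space_pair_measure)
  have "(\<lambda>p. measure (K (fst p)) {z \<in> space (PM R). z j \<le> snd p}) \<in> borel_measurable (PM L \<Otimes>\<^sub>M borel)"
  proof (rule measure_measurable_prob_algebra2)
    show "(SIGMA p:space (PM L \<Otimes>\<^sub>M borel). {z \<in> space (PM R). z j \<le> snd p}) \<in> sets ((PM L \<Otimes>\<^sub>M borel) \<Otimes>\<^sub>M PM R)"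
      unfolding eq by measurable
  qed measurable
  then show ?thesis
  proof (rule measurable_cong[THEN iffD1, rotated])
    fix p assume "p \<in> space (PM L \<Otimes>\<^sub>M (borel :: real measure))"
    then have "K (fst p) \<in> space (prob_algebra (PM R))"
      by (intro measurable_space[OF K]) (auto simp: space_pair_measure)
    then have "space (K (fst p)) = space (PM R)"
      by (intro sets_eq_imp_space_eq) (simp add: space_prob_algebra)
    then show "measure (K (fst p)) {z \<in> space (PM R). z j \<le> snd p} = (case p of (w, v) \<Rightarrow> cond_df K j v w)"
      by (simp add: cond_df_def split_beta)
  qed
qed

text \<open>A kernel chosen by \<open>SOME\<close> is explicit only almost everywhere; replacing it
  under an integral requires measurability of the original integrand.\<close>

lemma cond_copula_measurable:
  assumes K: "K \<in> measurable (PM L) (prob_algebra (PM R))"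
  shows "cond_copula R K \<in> measurable (PM L) (prob_algebra (PM R))"
  unfolding cond_copula_def[abs_def]
proof (rule measurable_distr_prob_space2[OF K])
  have "(\<lambda>p. \<lambda>j\<in>R. cond_df K j (snd p j) (fst p)) \<in> measurable (PM L \<Otimes>\<^sub>M PM R) (PM R)"
    unfolding PM_def[of R]
  proof (rule measurable_restrict)
    fix j assume j: "j \<in> R"
    have "(\<lambda>p. (fst p, snd p j)) \<in> measurable (PM L \<Otimes>\<^sub>M PM R) (PM L \<Otimes>\<^sub>M borel)"
      using measurable_component_PM[OF j] by measurable
    from measurable_compose[OF this cond_df_measurable[OF K j]]
    show "(\<lambda>p. cond_df K j (snd p j) (fst p)) \<in> borel_measurable (PM L \<Otimes>\<^sub>M PiM R (\<lambda>_. borel))"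
      by (simp add: PM_def)
  qed
  then show "(\<lambda>(w, y). \<lambda>j\<in>R. cond_df K j (y j) w) \<in> measurable (PM L \<Otimes>\<^sub>M PM R) (PM R)"
    by (simp add: split_beta')
qed

section \<open>The D-vine step\<close>

lemma integral_half_sign_component:
  assumes "m \<in> M"
  shows "integrable (indep_copula M) (\<lambda>w. half_sign (w m))"
    and "(\<integral>w. half_sign (w m) \<partial>indep_copula M) = 0"
proof -
  interpret prob_space "indep_copula M" by (rule prob_space_indep_copula)
  have [measurable]: "(\<lambda>w. w m) \<in> borel_measurable (indep_copula M)"
    using assms by (simp cong: measurable_cong_sets add: measurable_component_PM)
  show "integrable (indep_copula M) (\<lambda>w. half_sign (w m))"
    by (intro integrable_const_bound[where B=1]) (auto simp: half_sign_def)
  have "(\<integral>w. half_sign (w m) \<partial>indep_copula M) = (\<integral>x. half_sign x \<partial>distr (indep_copula M) borel (\<lambda>w. w m))"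
    by (subst integral_distr) auto
  then show "(\<integral>w. half_sign (w m) \<partial>indep_copula M) = 0"
    by (simp add: distr_component_indep_copula assms integral_half_sign)
qed

text \<open>For almost every \<open>w\<close> the conditional copula has coefficient
  \<open>c * half_sign (w m)\<close>. Its value is \<open>a * b\<close> plus a multiple of
  \<open>half_sign (w m)\<close>, which has mean zero.\<close>

lemma partial_copula_parity_copula:
  assumes M: "finite M" "m \<in> M" "i \<notin> M" "e \<notin> M" "i \<noteq> e" and c: "\<bar>c\<bar> \<le> 1"
    and K: "is_rcd (parity_copula c {i, m, e} (M \<union> {i, e})) M {i, e} K"
    and ab: "0 \<le> a" "a \<le> 1" "0 \<le> b" "b \<le> 1"
  shows "(\<integral>w. cdf_on {i, e} (cond_copula {i, e} K w) (\<lambda>j. if j = i then a else b) \<partial>indep_copula M) = a * b"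
proof -
  let ?R = "{i, e}" and ?T = "{i, m, e}" and ?u = "\<lambda>j. if j = i then a else b"
  interpret prob_space "indep_copula M" by (rule prob_space_indep_copula)
  define S where "S x = (\<integral>y. half_sign y * indicator {..x} y \<partial>unif)" for x
  have T: "\<not> ?T \<subseteq> M" "?T \<inter> M = {m}" "?T \<inter> ?R = ?R" using M by auto
  have par: "parity {m} w = half_sign (w m)" for w by (simp add: parity_def)
  have H: "is_rcd (parity_copula c ?T (M \<union> ?R)) M ?R (\<lambda>w. parity_copula (c * half_sign (w m)) ?R ?R)"
    using is_rcd_parity_copula[of M ?R ?T c] M c T(1) unfolding T(2,3) par by auto
  have m: "marg M (parity_copula c ?T (M \<union> ?R)) = indep_copula M"
    using M c T(1) by (subst marg_parity_copula) auto
  have "AE w in indep_copula M. K w = parity_copula (c * half_sign (w m)) ?R ?R"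
    using is_rcd_unique[OF K H] prob_space_indep_copula unfolding m by simp
  then have AE: "AE w in indep_copula M. cdf_on ?R (cond_copula ?R K w) ?u = a * b + c * S a * S b * half_sign (w m)"
  proof eventually_elim
    case (elim w)
    have c': "\<bar>c * half_sign (w m)\<bar> \<le> 1" using c by (auto simp: half_sign_def)
    \<comment> \<open>\<open>K w\<close> already has uniform margins, so passing to its copula
      changes nothing.\<close>
    then have "is_copula ?R (K w)"
      unfolding elim using M by (intro is_copula_parity_copula) auto
    then have "cond_copula ?R K w = parity_copula (c * half_sign (w m)) ?R ?R"
      using cond_copula_copula[of ?R K w] elim by simp
    then show ?case
      using cdf_on_parity_copula[of ?R ?R, OF _ _ c'] M ab by (simp add: S_def max_def min_def)
  qed
  have cc: "cond_copula ?R K \<in> measurable (PM M) (prob_algebra (PM ?R))"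
    using K by (intro cond_copula_measurable) (simp add: is_rcd_def)
  have "(\<lambda>w. cdf_on ?R (cond_copula ?R K w) ?u) \<in> borel_measurable (PM M)"
    unfolding cdf_on_def
    by (rule measurable_compose[OF cc measurable_measure_prob_algebra[OF box_in_sets]]) simp
  then have meas: "(\<lambda>w. cdf_on ?R (cond_copula ?R K w) ?u) \<in> borel_measurable (indep_copula M)"
    by (simp cong: measurable_cong_sets)
  note int = integral_half_sign_component[OF M(2)]
  have "(\<integral>w. cdf_on ?R (cond_copula ?R K w) ?u \<partial>indep_copula M) =
      (\<integral>w. a * b + c * S a * S b * half_sign (w m) \<partial>indep_copula M)"
    using int(1) by (intro integral_cong_AE meas AE) simp
  also have "\<dots> = a * b"
    using int prob_space by simp
  finally show ?thesis .
qed

lemma copula_of_cdf_eq: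
  assumes "finite J" "is_copula J \<nu>" "\<And>u. u \<in> unit_cube J \<Longrightarrow> cdf_on J \<nu> u = F u"
  shows "copula_of_cdf J F = \<nu>"
proof -
  have "is_copula J (copula_of_cdf J F) \<and> (\<forall>u\<in>unit_cube J. cdf_on J (copula_of_cdf J F) u = F u)"
    unfolding copula_of_cdf_def by (rule someI[of _ \<nu>]) (use assms in auto)
  then show ?thesis
    using assms by (intro copula_eqI[of J]) auto
qed

text \<open>Valid for every \<open>t\<close>, so that a formula for the partial copula on the unit
  square can be applied pointwise under the integral.\<close>

lemma cond_df_range:
  assumes "K \<in> measurable (PM L) (prob_algebra (PM R))" "t \<in> space (PM L)"
  shows "0 \<le> cond_df K j v t" "cond_df K j v t \<le> 1"
proof -
  have "K t \<in> space (prob_algebra (PM R))" using assms by (rule measurable_space)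
  then interpret prob_space "K t" by (simp add: space_prob_algebra)
  show "0 \<le> cond_df K j v t" "cond_df K j v t \<le> 1" by (simp_all add: cond_df_def)
qed

text \<open>One lemma for all edges above the first tree: \<open>c = 0\<close> where the margin on
  \<open>{i..e}\<close> is independent, \<open>c = 1\<close> at the top. The partial copula is the
  product, and the conditional distribution functions are almost surely the identity on the unit
  interval.\<close>

lemma pvc_step_indep:
  fixes i k :: nat
  defines "M \<equiv> {i+1..i+k+1}" and "e \<equiv> i + k + 2"
  assumes \<nu>M: "pvc \<mu> (i+1) k = indep_copula M"
    and left: "pvc \<mu> i (Suc k) = indep_copula (M \<union> {i})"
    and right: "pvc \<mu> (i+1) (Suc k) = indep_copula (M \<union> {e})"
    and m: "marg {i..e} \<mu> = parity_copula c {i, i+1, e} (M \<union> {i, e})" and c: "\<bar>c\<bar> \<le> 1"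
  shows "pvc \<mu> i (Suc (Suc k)) = indep_copula {i..e}"
proof -
  have J: "{i..e} = insert i (insert e M)" and M: "finite M" "i + 1 \<in> M" "i \<notin> M" "e \<notin> M" "i \<noteq> e"
    by (auto simp: M_def e_def)
  \<comment> \<open>These definitions copy the local terms of \<open>pvc\<close>, so that its
    unfolding matches at the end. The explicit kernels witness that the choices exist.\<close>
  define KL where "KL = (SOME K. is_rcd (indep_copula (M \<union> {i})) M {i} K)"
  define KR where "KR = (SOME K. is_rcd (indep_copula (M \<union> {e})) M {e} K)"
  define KC where "KC = (SOME K. is_rcd (parity_copula c {i, i+1, e} (M \<union> {i, e})) M {i, e} K)"
  define Cp where "Cp a b = (\<integral>w. cdf_on {i, e} (cond_copula {i, e} KC w) (\<lambda>j. if j = i then a else b) \<partial>indep_copula M)" for a b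
  define F where "F u = (\<integral>t. indicator {t. \<forall>m\<in>M. 0 \<le> t m \<and> t m \<le> u m} t *
      Cp (cond_df KL i (u i) t) (cond_df KR e (u e) t) \<partial>indep_copula M)" for u
  have KL: "is_rcd (indep_copula (M \<union> {i})) M {i} KL"
    unfolding KL_def by (rule someI[where P="is_rcd (indep_copula (M \<union> {i})) M {i}"], rule is_rcd_indep_copula) (use M in auto)
  have KR: "is_rcd (indep_copula (M \<union> {e})) M {e} KR"
    unfolding KR_def by (rule someI[where P="is_rcd (indep_copula (M \<union> {e})) M {e}"], rule is_rcd_indep_copula) (use M in auto)
  have KC: "is_rcd (parity_copula c {i, i+1, e} (M \<union> {i, e})) M {i, e} KC"
    unfolding KC_def by (rule someI[where P="is_rcd (parity_copula c {i, i+1, e} (M \<union> {i, e})) M {i, e}"], rule is_rcd_parity_copula) (use M c in auto)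
  have Cp: "Cp a b = a * b" if "0 \<le> a" "a \<le> 1" "0 \<le> b" "b \<le> 1" for a b
    unfolding Cp_def using that M c KC by (intro partial_copula_parity_copula) auto
  have "cdf_on {i..e} (indep_copula {i..e}) u = F u" if u: "u \<in> unit_cube {i..e}" for u
  proof -
    have u01: "0 \<le> u j" "u j \<le> 1" if "j \<in> {i..e}" for j
      using u that by (auto simp: unit_cube_def)
    have clamp: "max 0 (min 1 (u j)) = u j" if "j \<in> insert i (insert e M)" for j
      using u01[of j] that J by auto
    have KLm: "KL \<in> measurable (PM M) (prob_algebra (PM {i}))" and KRm: "KR \<in> measurable (PM M) (prob_algebra (PM {e}))"
      using KL KR by (auto simp: is_rcd_def)
    let ?box = "PiE M (\<lambda>m. {0..u m})"
    have box: "?box \<in> sets (PM M)"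
      unfolding PM_def using M by (intro sets_PiM_I_finite) auto
    \<comment> \<open>The partial copula is replaced pointwise; on extensional functions the two
      indicators agree. The conditional distribution functions are known only almost everywhere and
      follow separately.\<close>
    have "F u = (\<integral>t. indicator ?box t * (cond_df KL i (u i) t * cond_df KR e (u e) t) \<partial>indep_copula M)"
      unfolding F_def
      using cond_df_range[OF KLm] cond_df_range[OF KRm]
      by (intro Bochner_Integration.integral_cong refl)
         (auto simp: Cp space_PM PiE_def Pi_def split: split_indicator)
    also have "\<dots> = (\<integral>t. u i * u e * indicator ?box t \<partial>indep_copula M)"
    proof (rule integral_cong_AE)
      have "(\<lambda>t. cond_df KL i (u i) t) \<in> borel_measurable (PM M)"
        using measurable_compose[OF _ cond_df_measurable[OF KLm], of "\<lambda>t. (t, u i)" "PM M" i] by simp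
      moreover have "(\<lambda>t. cond_df KR e (u e) t) \<in> borel_measurable (PM M)"
        using measurable_compose[OF _ cond_df_measurable[OF KRm], of "\<lambda>t. (t, u e)" "PM M" e] by simp
      ultimately show "(\<lambda>t. indicator ?box t * (cond_df KL i (u i) t * cond_df KR e (u e) t)) \<in> borel_measurable (indep_copula M)"
        using box by (auto cong: measurable_cong_sets)
      show "(\<lambda>t. u i * u e * indicator ?box t) \<in> borel_measurable (indep_copula M)"
        using box by (auto cong: measurable_cong_sets)
      have "AE t in indep_copula M. KL t = indep_copula {i}" "AE t in indep_copula M. KR t = indep_copula {e}"
        using M KL KR by (auto intro!: is_rcd_indep_copula_unique)
      then show "AE t in indep_copula M. indicator ?box t * (cond_df KL i (u i) t * cond_df KR e (u e) t) =
          u i * u e * indicator ?box t"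
      proof eventually_elim
        case (elim t)
        then have "cond_df KL i (u i) t = u i" "cond_df KR e (u e) t = u e"
          using cond_df_copula[of "{i}" KL t i] cond_df_copula[of "{e}" KR t e] clamp
          by (auto simp: is_copula_indep_copula)
        then show ?case by simp
      qed
    qed
    also have "\<dots> = u i * u e * measure (indep_copula M) ?box"
      using box sets.sets_into_space[OF box] by (simp add: Int_absorb2)
    also have "measure (indep_copula M) ?box = (\<Prod>j\<in>M. measure unif {0..u j})"
      using measure_parity_copula_box[of M "{}" 0 "\<lambda>m. {0..u m}"] M by simp
    also have "\<dots> = (\<Prod>j\<in>M. u j)"
    proof (rule prod.cong[OF refl])
      fix j assume "j \<in> M"
      then have "0 \<le> u j" "u j \<le> 1" using u01[of j] J by auto
      then have "emeasure unif {0..u j} = ennreal (u j)"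
        by (simp add: unif_def divide_ennreal_def)
      then show "measure unif {0..u j} = u j" using \<open>0 \<le> u j\<close> by (simp add: measure_def)
    qed
    finally show ?thesis
      using M clamp unfolding J by (subst cdf_on_indep_copula) auto
  qed
  then have "copula_of_cdf {i..e} F = indep_copula {i..e}"
    by (intro copula_of_cdf_eq is_copula_indep_copula) auto
  moreover have "pvc \<mu> i (Suc (Suc k)) = copula_of_cdf {i..e} F"
    unfolding pvc.simps Let_def F_def[abs_def] Cp_def[abs_def] KL_def KR_def KC_def left[symmetric] right[symmetric]
      \<nu>M[symmetric] m[symmetric] unfolding M_def e_def ..
  ultimately show ?thesis by simp
qed

section \<open>The lower bound\<close>

text \<open>Strong induction, since the step uses levels \<open>k - 1\<close> and
  \<open>k - 2\<close>. Only the edge from 1 to \<open>d\<close> sees all of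
  \<open>{1, 2, d}\<close>.\<close>

lemma pvc_parity_copula:
  fixes d :: nat
  defines "\<mu> \<equiv> parity_copula 1 {1, 2, d} {1..d}"
  assumes d: "3 \<le> d" and "1 \<le> i" "i + k \<le> d"
  shows "pvc \<mu> i k = indep_copula {i..i+k}"
  using assms(3,4)
proof (induction k arbitrary: i rule: less_induct)
  case (less k)
  let ?T = "{1, 2, d}"
  have marg: "marg W \<mu> = (if ?T \<subseteq> W then parity_copula 1 ?T W else indep_copula W)" if "W \<subseteq> {1..d}" for W
    unfolding \<mu>_def using that d by (intro marg_parity_copula) auto
  then have marg_indep: "marg W \<mu> = indep_copula W" if "W \<subseteq> {1..d}" "\<not> ?T \<subseteq> W" for W
    using that by (simp only: if_False)
  consider "k = 0" | "k = 1" | n where "k = Suc (Suc n)"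
    by (metis One_nat_def not0_implies_Suc)
  then show ?case
  proof cases
    case 1
    have "\<not> ?T \<subseteq> {i}" by auto
    then show ?thesis using marg_indep[of "{i}"] less.prems 1 by simp
  next
    case 2
    have "\<not> ?T \<subseteq> {i, i+1}" "{i..i+1} = {i, i+1}" using d by auto
    then show ?thesis using marg_indep[of "{i, i+1}"] less.prems 2 by simp
  next
    case 3
    define M where "M = {i+1..i+n+1}"
    define e where "e = i + n + 2"
    have J: "{i..e} = M \<union> {i, e}" and l: "{i..i + Suc n} = M \<union> {i}" and r: "{i+1..i + 1 + Suc n} = M \<union> {e}"
      by (auto simp: M_def e_def)
    \<comment> \<open>At the top edge \<open>i + 1 = 2\<close>, so \<open>{i, i+1, e}\<close> is the
      triple and \<open>c = 1\<close>; elsewhere independence is written with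
      \<open>c = 0\<close>.\<close>
    have "\<exists>c. \<bar>c\<bar> \<le> 1 \<and> marg {i..e} \<mu> = parity_copula c {i, i+1, e} {i..e}"
    proof (cases "i = 1 \<and> e = d")
      case True
      then have "?T = {i, i+1, e}" by auto
      moreover have "?T \<subseteq> {i..e}" using True d by auto
      ultimately show ?thesis
        using marg[of "{i..e}"] True by (intro exI[of _ 1]) (simp only: if_True, simp)
    next
      case False
      have "\<not> ?T \<subseteq> {i..e}" using False less.prems 3 by (auto simp: e_def)
      moreover have "{i..e} \<subseteq> {1..d}" using less.prems 3 by (auto simp: e_def)
      ultimately show ?thesis
        using marg_indep[of "{i..e}"] by (intro exI[of _ 0]) simp
    qed
    then obtain c where c: "\<bar>c\<bar> \<le> 1" "marg {i..e} \<mu> = parity_copula c {i, i+1, e} {i..e}" by blast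
    have "pvc \<mu> (i+1) n = indep_copula M"
      using less.IH[of n "i+1"] less.prems 3 by (simp add: M_def)
    moreover have "pvc \<mu> i (Suc n) = indep_copula (M \<union> {i})"
      using less.IH[of "Suc n" i] less.prems 3 unfolding l by simp
    moreover have "pvc \<mu> (i+1) (Suc n) = indep_copula (M \<union> {e})"
      using less.IH[of "Suc n" "i+1"] less.prems 3 unfolding r by simp
    ultimately have "pvc \<mu> i (Suc (Suc n)) = indep_copula {i..e}"
      using pvc_step_indep[of \<mu> i n c] c J unfolding M_def e_def by simp
    then show ?thesis by (simp add: 3 e_def)
  qed
qed

section \<open>Distances between copulas and their boundedness\<close>

lemma cdf_on_copula_range:
  assumes "is_copula J \<nu>"
  shows "0 \<le> cdf_on J \<nu> u" "cdf_on J \<nu> u \<le> 1"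
proof -
  interpret prob_space \<nu> using assms by (simp add: is_copula_def)
  show "0 \<le> cdf_on J \<nu> u" "cdf_on J \<nu> u \<le> 1" by (simp_all add: cdf_on_def)
qed

lemma abs_cdf_on_copula_diff_le:
  assumes "is_copula J \<mu>" "is_copula J \<nu>"
  shows "\<bar>cdf_on J \<mu> u - cdf_on J \<nu> u\<bar> \<le> 1"
  using cdf_on_copula_range[OF assms(1), of u] cdf_on_copula_range[OF assms(2), of u] by linarith

lemma abs_cdf_on_diff_le_d_inf:
  assumes "is_copula J \<mu>" "is_copula J \<nu>" "u \<in> unit_cube J"
  shows "\<bar>cdf_on J \<mu> u - cdf_on J \<nu> u\<bar> \<le> d_inf J \<mu> \<nu>"
  unfolding d_inf_def
  using assms abs_cdf_on_copula_diff_le[OF assms(1,2)] by (intro cSUP_upper bdd_aboveI2) auto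

lemma d_inf_parity_copula:
  assumes J: "finite J" and T: "T \<subseteq> J" "card T = 3"
  shows "1/8 \<le> d_inf J (parity_copula 1 T J) (indep_copula J)"
proof -
  \<comment> \<open>Both the uniform mass of \<open>{..1/2}\<close> and the integral of
    \<open>half_sign\<close> over it are 1/2, so the independent part and the perturbation are each
    1/8 at this point.\<close>
  define u :: "nat \<Rightarrow> real" where "u j = (if j \<in> T then 1/2 else 1)" for j
  have prod: "(\<Prod>j\<in>J. u j) = 1/8"
    using J T by (simp add: u_def prod.If_cases Int_absorb1 power3_eq_cube)
  have "(\<Prod>j\<in>J. max 0 (min 1 (u j))) = (\<Prod>j\<in>J. u j)"
    by (intro prod.cong) (auto simp: u_def)
  moreover have "(\<Prod>j\<in>J. if j \<in> T then (\<integral>x. half_sign x * indicator {..u j} x \<partial>unif) else max 0 (min 1 (u j))) = (\<Prod>j\<in>J. u j)"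
    by (intro prod.cong) (auto simp: u_def integral_half_sign_half)
  ultimately have "cdf_on J (parity_copula 1 T J) u - cdf_on J (indep_copula J) u = 1/8"
    using cdf_on_parity_copula[OF J T(1), of 1 u] cdf_on_indep_copula[OF J, of u] prod by simp
  moreover have "u \<in> unit_cube J" by (auto simp: unit_cube_def u_def)
  moreover have "is_copula J (parity_copula 1 T J)"
    using J T by (intro is_copula_parity_copula) auto
  ultimately show ?thesis
    using abs_cdf_on_diff_le_d_inf[OF _ is_copula_indep_copula, of J "parity_copula 1 T J" u] by simp
qed

text \<open>If no copula fits, the predicate under \<open>SOME\<close> equals the constantly false
  one, so the value is the same for all \<open>J\<close> and \<open>F\<close>.\<close>

lemma copula_of_cdf_cases:
  "is_copula J (copula_of_cdf J F) \<or> copula_of_cdf J F = (SOME \<nu>. False)"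
proof (cases "\<exists>\<nu>. is_copula J \<nu> \<and> (\<forall>u\<in>unit_cube J. cdf_on J \<nu> u = F u)")
  case True
  from someI_ex[OF this] show ?thesis by (simp add: copula_of_cdf_def)
next
  case False
  then have "(is_copula J \<nu> \<and> (\<forall>u\<in>unit_cube J. cdf_on J \<nu> u = F u)) = False" for \<nu> by blast
  then show ?thesis unfolding copula_of_cdf_def by (simp only: simp_thms)
qed

text \<open>When no copula has the prescribed distribution function, \<^const>\<open>copula_of_cdf\<close> is one fixed
  junk measure, and the supremum of a set of reals that is unbounded above is one fixed junk number;
  so \<^const>\<open>d_inf\<close> stays bounded in every case.\<close>

lemma bdd_above_d_inf_copula_of_cdf:
  "\<exists>B. \<forall>\<mu> F. is_copula J \<mu> \<longrightarrow> d_inf J \<mu> (copula_of_cdf J F) \<le> B"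
proof -
  define N :: "(nat \<Rightarrow> real) measure" where "N = (SOME \<nu>. False)"
  have ne: "unit_cube J \<noteq> {}" by (auto simp: unit_cube_def intro!: exI[of _ "\<lambda>_. 0"])
  have "\<exists>B. \<forall>\<mu>. is_copula J \<mu> \<longrightarrow> d_inf J \<mu> N \<le> B"
  proof (cases "\<exists>b. \<forall>u\<in>unit_cube J. cdf_on J N u \<le> b")
    case True
    then obtain b where b: "\<And>u. u \<in> unit_cube J \<Longrightarrow> cdf_on J N u \<le> b" by auto
    have "d_inf J \<mu> N \<le> 1 + b" if \<mu>: "is_copula J \<mu>" for \<mu>
      unfolding d_inf_def
    proof (rule cSUP_least[OF ne])
      fix u assume "u \<in> unit_cube J"
      moreover have "0 \<le> cdf_on J N u" by (simp add: cdf_on_def)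
      ultimately show "\<bar>cdf_on J \<mu> u - cdf_on J N u\<bar> \<le> 1 + b"
        using b[of u] cdf_on_copula_range[OF \<mu>, of u] by linarith
    qed
    then show ?thesis by blast
  next
    case False
    have "d_inf J \<mu> N = (LEAST z. False)" if \<mu>: "is_copula J \<mu>" for \<mu>
    proof -
      \<comment> \<open>A bound on the differences would bound \<open>cdf_on J N\<close>. So the
        predicate under \<open>LEAST\<close> in \<open>Sup_real_def\<close> is constantly false, and
        the supremum is the same number for every \<open>\<mu>\<close>.\<close>
      have "(\<forall>x\<in>(\<lambda>u. \<bar>cdf_on J \<mu> u - cdf_on J N u\<bar>) ` unit_cube J. x \<le> z) = False" for z
      proof (simp only: eq_False, rule notI)
        assume z: "\<forall>x\<in>(\<lambda>u. \<bar>cdf_on J \<mu> u - cdf_on J N u\<bar>) ` unit_cube J. x \<le> z"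
        have "cdf_on J N u \<le> z + 1" if "u \<in> unit_cube J" for u
        proof -
          have "\<bar>cdf_on J \<mu> u - cdf_on J N u\<bar> \<le> z" using z that by blast
          then show ?thesis using cdf_on_copula_range[OF \<mu>, of u] by linarith
        qed
        with False show False by blast
      qed
      then show ?thesis unfolding d_inf_def Sup_real_def by (simp only:)
    qed
    then show ?thesis by (intro exI[of _ "LEAST z. False"]) auto
  qed
  then obtain B where B: "\<And>\<mu>. is_copula J \<mu> \<Longrightarrow> d_inf J \<mu> N \<le> B" by blast
  have "d_inf J \<mu> (copula_of_cdf J F) \<le> max 1 B" if \<mu>: "is_copula J \<mu>" for \<mu> F
    using copula_of_cdf_cases[of J F]
  proof
    assume "is_copula J (copula_of_cdf J F)"
    then have "d_inf J \<mu> (copula_of_cdf J F) \<le> 1"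
      unfolding d_inf_def using \<mu> ne by (intro cSUP_least abs_cdf_on_copula_diff_le) auto
    then show ?thesis by simp
  next
    assume "copula_of_cdf J F = (SOME \<nu>. False)"
    then show ?thesis using B[OF \<mu>] by (simp add: N_def)
  qed
  then show ?thesis by blast
qed

text \<open>For \<open>3 \<le> d\<close> the last level falls under the recursive equation. The
  uniform bound thus covers \<open>psi\<close> on all of \<open>Cc\<close>, whether or not
  \<open>F\<close> belongs to a copula.\<close>

lemma psi_eq_copula_of_cdf:
  assumes "3 \<le> d"
  shows "\<exists>F. psi d \<mu> = copula_of_cdf {1..d} F"
proof -
  obtain k where k: "d = k + 3" using assms le_Suc_ex by (metis add.commute)
  then have "d - 1 = Suc (Suc k)" and d: "1 + k + 2 = d" by auto
  then show ?thesis unfolding psi_def by (simp only: pvc.simps Let_def d) blast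
qed

theorem theorem7p6:
  fixes d :: nat
  assumes "3 \<le> d"
  shows "(\<exists>\<mu>. Cc d \<mu> \<and> d_inf {1..d} \<mu> (psi d \<mu>) \<ge> 1/8) \<and>
         (SUP \<mu> \<in> {\<mu>. Cc d \<mu>}. d_inf {1..d} \<mu> (psi d \<mu>)) \<ge> 1/8"
proof -
  let ?\<mu> = "parity_copula 1 {1, 2, d} {1..d}"
  have T: "{1, 2, d} \<subseteq> {1..d}" "card {1, 2, d} = 3" using assms by auto
  have Cc: "Cc d ?\<mu>" using T by (intro Cc_parity_copula) auto
  have "psi d ?\<mu> = indep_copula {1..d}"
    unfolding psi_def using assms by (subst pvc_parity_copula) auto
  then have ge: "1/8 \<le> d_inf {1..d} ?\<mu> (psi d ?\<mu>)"
    using d_inf_parity_copula[OF _ T] by simp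
  \<comment> \<open>A real \<open>SUP\<close> is guaranteed to dominate its elements only when they
    are bounded above, so the second claim requires a bound over all of \<open>Cc\<close>.\<close>
  obtain B where B: "\<And>\<mu> F. is_copula {1..d} \<mu> \<Longrightarrow> d_inf {1..d} \<mu> (copula_of_cdf {1..d} F) \<le> B"
    using bdd_above_d_inf_copula_of_cdf[of "{1..d}"] by blast
  have "d_inf {1..d} \<mu> (psi d \<mu>) \<le> B" if "Cc d \<mu>" for \<mu>
    using psi_eq_copula_of_cdf[OF assms, of \<mu>] B[of \<mu>] that by (auto simp: Cc_def)
  then have "d_inf {1..d} ?\<mu> (psi d ?\<mu>) \<le> (SUP \<mu> \<in> {\<mu>. Cc d \<mu>}. d_inf {1..d} \<mu> (psi d \<mu>))"
    using Cc by (intro cSUP_upper bdd_aboveI2) auto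
  with Cc ge show ?thesis by (meson order_trans)
qed

end
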